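(* Let $f$ range over a finite nonempty set of quark flavors, let $m_f>0$ be the quark masses, and let $\Sigma_{\rm F}>0$ (chiral condensate), $A_{\rm F}>0$ (pure Yang--Mills topological stiffness) and $f_a>0$ (axion decay constant) be given. Let the low-energy $\Theta$-dependent potential be $$V_{\rm F}(\Theta,\phi)=-\Sigma_{\rm F}\sum_f m_f\cos\phi_f+\frac{A_{\rm F}}{2}\Big(\Theta-\sum_f\phi_f\Big)^2 ,$$ and let $E_{\rm vac}(\Theta)$ be the vacuum energy obtained from $V_{\rm F}$ by eliminating the phases $\phi_f$ at the stationary point (as specified in the context). Then the topological susceptibility $\chi_{\rm top}^{\rm F}=\frac{d^2E_{\rm vac}}{d\Theta^2}\big|_{\Theta=0}$ is $$\chi_{\rm top}^{\rm F}=\left[\frac{1}{A_{\rm F}}+\sum_f\frac{1}{m_f\Sigma_{\rm F}}\right]^{-1}.$$ Consequently, if $\Theta=\theta_{\rm QCD}+a/f_a$ with $\theta_{\rm QCD}\in\mathbb{R}$ constant, $V_a(a)=E_{\rm vac}(\theta_{\rm QCD}+a/f_a)-E_{\rm vac}(0)$, and $m_a^2$ denotes the second derivative of $V_a$ with respect to $a$ at the point where $\Theta=0$, then $$m_a^2f_a^2=\chi_{\rm top}^{\rm F}.$$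
   Context: The variables $\phi=(\phi_f)_f$ are real light-quark chiral phases, one per flavor. For $\Theta$ in a neighborhood of $0$, let $\phi(\Theta)$ be the smooth solution of the stationarity equations $\partial V_{\rm F}/\partial\phi_f=0$ (for all $f$) with $\phi(0)=0$; the vacuum energy is $E_{\rm vac}(\Theta)=V_{\rm F}(\Theta,\phi(\Theta))$. The numbers $\Sigma_{\rm F}=-\langle\bar q q\rangle_{\rm F}$ and $A_{\rm F}=\chi_{\rm YM}^{\rm F}$ are treated as given inputs. *)

theory Defs
  imports "HOL-Analysis.Analysis"
begin

text \<open>
  Parameters throughout: the finite set \<open>F\<close> of flavors, the masses \<open>m\<close>, the condensate \<open>S\<close>
  (written Sigma in physics notation) and the Yang--Mills stiffness \<open>A\<close>.
  Phases are functions \<open>'f \<Rightarrow> real\<close>; only their values on \<open>F\<close> matter.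
\<close>

definition V_F :: "'f set \<Rightarrow> ('f \<Rightarrow> real) \<Rightarrow> real \<Rightarrow> real \<Rightarrow> real \<Rightarrow> ('f \<Rightarrow> real) \<Rightarrow> real" where
  "V_F F m S A \<Theta> \<phi> =
     - S * (\<Sum>f\<in>F. m f * cos (\<phi> f)) + A / 2 * (\<Theta> - (\<Sum>f\<in>F. \<phi> f))\<^sup>2"

text \<open>All partial derivatives in the phases exist and vanish.\<close>

definition stationary ::
    "'f set \<Rightarrow> ('f \<Rightarrow> real) \<Rightarrow> real \<Rightarrow> real \<Rightarrow> real \<Rightarrow> ('f \<Rightarrow> real) \<Rightarrow> bool" where
  "stationary F m S A \<Theta> \<phi> \<longleftrightarrow>
     (\<forall>f\<in>F. ((\<lambda>x. V_F F m S A \<Theta> (\<phi>(f := x))) has_real_derivative 0) (at (\<phi> f)))"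

text \<open>Infinite differentiability; meant for open \<open>U\<close>, since \<open>deriv\<close> is the two-sided derivative.\<close>

definition smooth_on :: "real set \<Rightarrow> (real \<Rightarrow> real) \<Rightarrow> bool" where
  "smooth_on U g \<longleftrightarrow> (\<forall>k. \<forall>x\<in>U. (deriv ^^ k) g field_differentiable (at x))"

text \<open>
  The values of \<open>\<phi>\<close> away from a neighborhood of \<open>0\<close> are unconstrained, so a solution
  is meaningful only as a germ at \<open>0\<close>.
\<close>

definition vacuum_branch ::
    "'f set \<Rightarrow> ('f \<Rightarrow> real) \<Rightarrow> real \<Rightarrow> real \<Rightarrow> (real \<Rightarrow> 'f \<Rightarrow> real) \<Rightarrow> bool" where
  "vacuum_branch F m S A \<phi> \<longleftrightarrow>
     (\<exists>U. open U \<and> 0 \<in> U \<and>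
          (\<forall>f\<in>F. smooth_on U (\<lambda>\<Theta>. \<phi> \<Theta> f)) \<and>
          (\<forall>\<Theta>\<in>U. stationary F m S A \<Theta> (\<phi> \<Theta>))) \<and>
     (\<forall>f\<in>F. \<phi> 0 f = 0)"

definition E_vac ::
    "'f set \<Rightarrow> ('f \<Rightarrow> real) \<Rightarrow> real \<Rightarrow> real \<Rightarrow> (real \<Rightarrow> 'f \<Rightarrow> real) \<Rightarrow> real \<Rightarrow> real" where
  "E_vac F m S A \<phi> \<Theta> = V_F F m S A \<Theta> (\<phi> \<Theta>)"

definition twice_differentiable_at :: "(real \<Rightarrow> real) \<Rightarrow> real \<Rightarrow> bool" where
  "twice_differentiable_at g x \<longleftrightarrow>
     (\<forall>\<^sub>F y in nhds x. g field_differentiable (at y)) \<and> deriv g field_differentiable (at x)"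

definition chi_top ::
    "'f set \<Rightarrow> ('f \<Rightarrow> real) \<Rightarrow> real \<Rightarrow> real \<Rightarrow> (real \<Rightarrow> 'f \<Rightarrow> real) \<Rightarrow> real" where
  "chi_top F m S A \<phi> = deriv (deriv (E_vac F m S A \<phi>)) 0"

definition V_a ::
    "'f set \<Rightarrow> ('f \<Rightarrow> real) \<Rightarrow> real \<Rightarrow> real \<Rightarrow> (real \<Rightarrow> 'f \<Rightarrow> real) \<Rightarrow> real \<Rightarrow> real \<Rightarrow> real \<Rightarrow> real"
  where
  "V_a F m S A \<phi> \<theta> f_a a = E_vac F m S A \<phi> (\<theta> + a / f_a) - E_vac F m S A \<phi> 0"

text \<open>The squared axion mass, with the point \<open>a\<close> of evaluation left as an argument.\<close>

definition axion_mass_sq ::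
    "'f set \<Rightarrow> ('f \<Rightarrow> real) \<Rightarrow> real \<Rightarrow> real \<Rightarrow> (real \<Rightarrow> 'f \<Rightarrow> real) \<Rightarrow> real \<Rightarrow> real \<Rightarrow> real \<Rightarrow> real"
  where
  "axion_mass_sq F m S A \<phi> \<theta> f_a a = deriv (deriv (V_a F m S A \<phi> \<theta> f_a)) a"

end

theory Submission
  imports Defs
begin

text \<open>
  Stationarity says that \<open>S m\<^sub>f sin \<phi>\<^sub>f\<close> has the common value \<open>\<lambda> = A (\<Theta> - \<Sum> \<phi>\<^sub>f)\<close>. Near the origin
  this means \<open>\<phi>\<^sub>f = arcsin (\<lambda> / (S m\<^sub>f))\<close>, where \<open>\<lambda>\<close> solves the scalar equation
  \<open>\<Theta> = \<lambda> / A + \<Sum> arcsin (\<lambda> / (S m\<^sub>f))\<close> with strictly increasing right-hand side; so a branch exists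
  and its germ is unique. By stationarity \<open>E_vac' = \<lambda>\<close>, and differentiating the scalar equation
  at \<open>0\<close> gives \<open>1 = \<lambda>'(0) (1 / A + \<Sum> 1 / (S m\<^sub>f))\<close>.
\<close>

section \<open>Derivatives\<close>

text \<open>
  If the generators in \<open>B\<close> have their derivatives on \<open>U\<close> in the algebra, then the algebra is closed
  under differentiation and all its members are smooth. This replaces a calculus of
  higher-order derivatives.
\<close>

inductive_set inv_closed_algebra :: "real set \<Rightarrow> (real \<Rightarrow> real) set \<Rightarrow> (real \<Rightarrow> real) set"
  for U :: "real set" and B :: "(real \<Rightarrow> real) set" where
  generator: "g \<in> B \<Longrightarrow> g \<in> inv_closed_algebra U B"
| const: "(\<lambda>x. c) \<in> inv_closed_algebra U B"
| add: "g \<in> inv_closed_algebra U B \<Longrightarrow> h \<in> inv_closed_algebra U B \<Longrightarrow>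
    (\<lambda>x. g x + h x) \<in> inv_closed_algebra U B"
| mult: "g \<in> inv_closed_algebra U B \<Longrightarrow> h \<in> inv_closed_algebra U B \<Longrightarrow>
    (\<lambda>x. g x * h x) \<in> inv_closed_algebra U B"
| inverse: "g \<in> inv_closed_algebra U B \<Longrightarrow> (\<And>x. x \<in> U \<Longrightarrow> g x \<noteq> 0) \<Longrightarrow>
    (\<lambda>x. inverse (g x)) \<in> inv_closed_algebra U B"

lemma inv_closed_algebra_sum:
  assumes "\<And>i. i \<in> I \<Longrightarrow> g i \<in> inv_closed_algebra U B"
  shows "(\<lambda>x. \<Sum>i\<in>I. g i x) \<in> inv_closed_algebra U B"
  using assms
  by (induction I rule: infinite_finite_induct) (auto intro: inv_closed_algebra.intros)

text \<open>Induction on the construction of \<open>g\<close>: the sum, product and reciprocal rules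
  build the derivative from members already obtained, and the generators are covered by
  \<open>gens\<close>.\<close>

lemma inv_closed_algebra_derivative:
  assumes gens: "\<And>b. b \<in> B \<Longrightarrow>
      \<exists>b'\<in>inv_closed_algebra U B. \<forall>x\<in>U. (b has_real_derivative b' x) (at x)"
    and "g \<in> inv_closed_algebra U B"
  shows "\<exists>g'\<in>inv_closed_algebra U B. \<forall>x\<in>U. (g has_real_derivative g' x) (at x)"
  using assms(2)
proof induction
  case (generator g)
  then show ?case by (rule gens)
next
  case (const c)
  show ?case
    by (rule bexI[of _ "\<lambda>x. 0"]) (auto intro: inv_closed_algebra.const)
next
  case (add g h)
  then obtain g' h' where "g' \<in> inv_closed_algebra U B" "h' \<in> inv_closed_algebra U B"
    and "\<forall>x\<in>U. (g has_real_derivative g' x) (at x)"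
    and "\<forall>x\<in>U. (h has_real_derivative h' x) (at x)" by blast
  then show ?case
    by (intro bexI[of _ "\<lambda>x. g' x + h' x"])
      (auto intro!: inv_closed_algebra.add derivative_eq_intros)
next
  case (mult g h)
  then obtain g' h' where "g' \<in> inv_closed_algebra U B" "h' \<in> inv_closed_algebra U B"
    and "\<forall>x\<in>U. (g has_real_derivative g' x) (at x)"
    and "\<forall>x\<in>U. (h has_real_derivative h' x) (at x)" by blast
  with mult.hyps show ?case
    by (intro bexI[of _ "\<lambda>x. g' x * h x + h' x * g x"])
      (auto intro!: inv_closed_algebra.add inv_closed_algebra.mult DERIV_mult)
next
  case (inverse g)
  then obtain g' where g': "g' \<in> inv_closed_algebra U B"
    and "\<forall>x\<in>U. (g has_real_derivative g' x) (at x)" by blast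
  \<comment> \<open>The derivative -g'/g^2 is spelled as a product of reciprocals so that the
    closure rules apply to it literally.\<close>
  then have "\<forall>x\<in>U. ((\<lambda>x. inverse (g x)) has_real_derivative
      (- 1) * (inverse (g x) * (g' x * inverse (g x)))) (at x)"
    using inverse.hyps(2) by (auto intro!: derivative_eq_intros)
  moreover have "(\<lambda>x. (- 1) * (inverse (g x) * (g' x * inverse (g x)))) \<in> inv_closed_algebra U B"
    by (intro inv_closed_algebra.mult inv_closed_algebra.const inv_closed_algebra.inverse
        inverse.hyps g')
  ultimately show ?case by (rule bexI)
qed

text \<open>Closure under differentiation can be iterated: at every order the derivative is again
  given on \<open>U\<close> by a member of the algebra, hence is differentiable there.\<close>

lemma inv_closed_algebra_smooth_on:
  assumes "open U"
    and gens: "\<And>b. b \<in> B \<Longrightarrow>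
      \<exists>b'\<in>inv_closed_algebra U B. \<forall>x\<in>U. (b has_real_derivative b' x) (at x)"
    and g: "g \<in> inv_closed_algebra U B"
  shows "smooth_on U g"
proof -
  have deriv_k: "\<exists>d\<in>inv_closed_algebra U B. \<forall>x\<in>U. ((deriv ^^ k) g has_real_derivative d x) (at x)"
    for k
  proof (induction k)
    case 0
    then show ?case
      using inv_closed_algebra_derivative[OF gens g] by simp
  next
    case (Suc k)
    then obtain d where d: "d \<in> inv_closed_algebra U B"
      and D: "\<forall>x\<in>U. ((deriv ^^ k) g has_real_derivative d x) (at x)" by blast
    from inv_closed_algebra_derivative[OF gens d] obtain d'
      where d': "d' \<in> inv_closed_algebra U B" "\<forall>x\<in>U. (d has_real_derivative d' x) (at x)" by blast
    \<comment> \<open>The iterated \<open>deriv\<close> is known only on \<open>U\<close>; openness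
      of \<open>U\<close> lets it inherit the derivative of \<open>d\<close>.\<close>
    have "d x = (deriv ^^ Suc k) g x" if "x \<in> U" for x
      using DERIV_imp_deriv[OF D[rule_format, OF that]] by simp
    then have "((deriv ^^ Suc k) g has_real_derivative d' x) (at x)" if "x \<in> U" for x
      using has_field_derivative_transform_within_open d'(2) \<open>open U\<close> that by blast
    with d' show ?case by blast
  qed
  show ?thesis
    unfolding smooth_on_def field_differentiable_def using deriv_k by blast
qed

text \<open>\<open>deriv g\<close> coincides with \<open>g'\<close> on a whole neighborhood of
  \<open>x\<close>, so both have the same derivative at \<open>x\<close>. A derivative at
  \<open>x\<close> alone would not suffice.\<close>

lemma second_derivative_from_local_derivative:
  assumes "\<forall>\<^sub>F y in nhds x. (g has_real_derivative g' y) (at y)"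
    and "(g' has_real_derivative D) (at x)"
  shows "twice_differentiable_at g x" and "deriv (deriv g) x = D"
proof -
  have "\<forall>\<^sub>F y in nhds x. g' y = deriv g y"
    using assms(1) by eventually_elim (simp add: DERIV_imp_deriv)
  then have "(deriv g has_real_derivative D) (at x)"
    using assms(2) DERIV_cong_ev[of x x g' "deriv g" D D] by simp
  then show "deriv (deriv g) x = D" and "twice_differentiable_at g x"
    using assms(1)
    by (auto simp: twice_differentiable_at_def field_differentiable_def DERIV_imp_deriv
        elim: eventually_mono)
qed

section \<open>Stationary phases\<close>

locale chiral_potential =
  fixes F :: "'f set" and m :: "'f \<Rightarrow> real" and S A :: real
  assumes finite: "finite F" and nonempty: "F \<noteq> {}"
    and m_pos: "f \<in> F \<Longrightarrow> m f > 0" and S_pos: "S > 0" and A_pos: "A > 0"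
begin

text \<open>This is the partial derivative of \<open>V_F\<close> in \<Theta> at fixed phases, and
  the common value \<lambda> of the stationarity equations.\<close>

definition tension :: "real \<Rightarrow> ('f \<Rightarrow> real) \<Rightarrow> real" where
  "tension \<Theta> \<phi> = A * (\<Theta> - (\<Sum>f\<in>F. \<phi> f))"

lemma V_F_partial_derivative:
  assumes "f \<in> F"
  shows "((\<lambda>x. V_F F m S A \<Theta> (\<phi>(f := x))) has_real_derivative
    S * m f * sin (\<phi> f) - tension \<Theta> \<phi>) (at (\<phi> f))"
proof -
  \<comment> \<open>Isolates the varied phase; \<open>u\<close> is generic so as to serve both the
    cosine sum and the plain sum of phases.\<close>
  have split: "(\<Sum>g\<in>F. u g ((\<phi>(f := x)) g)) = u f x + (\<Sum>g\<in>F - {f}. u g (\<phi> g))"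
    for u :: "'f \<Rightarrow> real \<Rightarrow> real" and x
    using finite assms by (subst sum.remove[of F f]) (auto intro!: sum.cong)
  have V: "V_F F m S A \<Theta> (\<phi>(f := x)) =
      - S * (m f * cos x + (\<Sum>g\<in>F - {f}. m g * cos (\<phi> g)))
      + A / 2 * (\<Theta> - (x + (\<Sum>g\<in>F - {f}. \<phi> g)))\<^sup>2" for x
    unfolding V_F_def split[of "\<lambda>g y. m g * cos y"] split[of "\<lambda>g y. y"] ..
  have "tension \<Theta> \<phi> = A * (\<Theta> - (\<phi> f + (\<Sum>g\<in>F - {f}. \<phi> g)))"
    using finite assms by (simp add: tension_def sum.remove)
  then show ?thesis
    unfolding V by (auto intro!: derivative_eq_intros simp: field_simps)
qed

lemma stationary_iff:
  "stationary F m S A \<Theta> \<phi> \<longleftrightarrow> (\<forall>f\<in>F. S * m f * sin (\<phi> f) = tension \<Theta> \<phi>)"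
proof -
  have "((\<lambda>x. V_F F m S A \<Theta> (\<phi>(f := x))) has_real_derivative 0) (at (\<phi> f)) \<longleftrightarrow>
      S * m f * sin (\<phi> f) = tension \<Theta> \<phi>" if "f \<in> F" for f
    using V_F_partial_derivative[OF that, of \<Theta> \<phi>]
    by (auto dest: DERIV_unique[OF V_F_partial_derivative[OF that, of \<Theta> \<phi>]])
  then show ?thesis by (simp add: stationary_def)
qed

text \<open>Sine is strictly increasing on this range, so a larger tension would make every phase at
  least as large. The sum of the phases enters the tension with a negative sign, which is a
  contradiction.\<close>

lemma tension_le:
  assumes \<phi>: "stationary F m S A \<Theta> \<phi>" "\<And>f. f \<in> F \<Longrightarrow> \<bar>\<phi> f\<bar> < pi / 2"
    and \<psi>: "stationary F m S A \<Theta> \<psi>" "\<And>f. f \<in> F \<Longrightarrow> \<bar>\<psi> f\<bar> < pi / 2"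
  shows "tension \<Theta> \<phi> \<le> tension \<Theta> \<psi>"
proof (rule ccontr)
  assume "\<not> ?thesis"
  then have less: "tension \<Theta> \<psi> < tension \<Theta> \<phi>" by simp
  have "\<psi> f \<le> \<phi> f" if "f \<in> F" for f
  proof -
    have "S * m f * sin (\<psi> f) < S * m f * sin (\<phi> f)"
      using less \<phi>(1) \<psi>(1) that by (simp add: stationary_iff)
    then have "sin (\<psi> f) < sin (\<phi> f)"
      using m_pos[OF that] S_pos by simp
    then show ?thesis
      using \<phi>(2)[OF that] \<psi>(2)[OF that] sin_mono_less_eq[of "\<psi> f" "\<phi> f"] by auto
  qed
  then have "(\<Sum>f\<in>F. \<psi> f) \<le> (\<Sum>f\<in>F. \<phi> f)" by (rule sum_mono)
  then have "tension \<Theta> \<phi> \<le> tension \<Theta> \<psi>"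
    using A_pos by (simp add: tension_def)
  with less show False by simp
qed

text \<open>By symmetry of \<open>tension_le\<close> the tensions agree, hence the sines, and sine
  is injective on the given range.\<close>

lemma stationary_unique:
  assumes \<phi>: "stationary F m S A \<Theta> \<phi>" "\<And>f. f \<in> F \<Longrightarrow> \<bar>\<phi> f\<bar> < pi / 2"
    and \<psi>: "stationary F m S A \<Theta> \<psi>" "\<And>f. f \<in> F \<Longrightarrow> \<bar>\<psi> f\<bar> < pi / 2"
    and f: "f \<in> F"
  shows "\<phi> f = \<psi> f"
proof -
  have "tension \<Theta> \<phi> = tension \<Theta> \<psi>"
    using tension_le[OF \<phi> \<psi>] tension_le[OF \<psi> \<phi>] by simp
  then have "S * m f * sin (\<phi> f) = S * m f * sin (\<psi> f)"
    using \<phi>(1) \<psi>(1) f by (simp add: stationary_iff)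
  then have "sin (\<phi> f) = sin (\<psi> f)"
    using m_pos[OF f] S_pos by simp
  then show ?thesis
    using \<phi>(2)[OF f] \<psi>(2)[OF f] by (auto intro: sin_inj_pi[of "\<phi> f" "\<psi> f"])
qed

section \<open>The vacuum branch\<close>

lemma vacuum_branchE:
  assumes "vacuum_branch F m S A \<phi>"
  obtains U \<phi>' where "open U" "0 \<in> U" "\<And>\<Theta>. \<Theta> \<in> U \<Longrightarrow> stationary F m S A \<Theta> (\<phi> \<Theta>)"
    "\<And>f. f \<in> F \<Longrightarrow> \<phi> 0 f = 0"
    "\<And>f \<Theta>. f \<in> F \<Longrightarrow> \<Theta> \<in> U \<Longrightarrow> ((\<lambda>\<Theta>. \<phi> \<Theta> f) has_real_derivative \<phi>' f \<Theta>) (at \<Theta>)"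
proof -
  obtain U where U: "open U" "0 \<in> U" "\<forall>f\<in>F. smooth_on U (\<lambda>\<Theta>. \<phi> \<Theta> f)"
    "\<forall>\<Theta>\<in>U. stationary F m S A \<Theta> (\<phi> \<Theta>)" "\<forall>f\<in>F. \<phi> 0 f = 0"
    using assms unfolding vacuum_branch_def by blast
  have "((\<lambda>\<Theta>. \<phi> \<Theta> f) has_real_derivative deriv (\<lambda>\<Theta>. \<phi> \<Theta> f) \<Theta>) (at \<Theta>)"
    if "f \<in> F" "\<Theta> \<in> U" for f \<Theta>
  proof -
    \<comment> \<open>Order 0 of smoothness is differentiability of the phase itself.\<close>
    have "((deriv ^^ 0) (\<lambda>\<Theta>. \<phi> \<Theta> f)) field_differentiable (at \<Theta>)"
      using U(3) that unfolding smooth_on_def by blast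
    then show ?thesis by (simp add: field_differentiable_derivI)
  qed
  with U show ?thesis
    by (intro that[of U "\<lambda>f. deriv (\<lambda>\<Theta>. \<phi> \<Theta> f)"]) auto
qed

text \<open>Continuity and vanishing at 0 bring the phases into the range of
  \<open>stationary_unique\<close>; finiteness of \<open>F\<close> gives one neighborhood for all
  flavors.\<close>

lemma vacuum_branch_eventually:
  assumes "vacuum_branch F m S A \<phi>"
  shows "\<forall>\<^sub>F \<Theta> in nhds 0. stationary F m S A \<Theta> (\<phi> \<Theta>) \<and> (\<forall>f\<in>F. \<bar>\<phi> \<Theta> f\<bar> < pi / 2)"
proof -
  from assms obtain U \<phi>' where U: "open U" "0 \<in> U"
    and stat: "\<And>\<Theta>. \<Theta> \<in> U \<Longrightarrow> stationary F m S A \<Theta> (\<phi> \<Theta>)"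
    and zero: "\<And>f. f \<in> F \<Longrightarrow> \<phi> 0 f = 0"
    and deriv: "\<And>f \<Theta>. f \<in> F \<Longrightarrow> \<Theta> \<in> U \<Longrightarrow>
      ((\<lambda>\<Theta>. \<phi> \<Theta> f) has_real_derivative \<phi>' f \<Theta>) (at \<Theta>)"
    by (rule vacuum_branchE) blast
  have "\<forall>\<^sub>F \<Theta> in nhds 0. \<bar>\<phi> \<Theta> f\<bar> < pi / 2" if "f \<in> F" for f
  proof -
    have "isCont (\<lambda>\<Theta>. \<phi> \<Theta> f) 0"
      using deriv[OF that U(2)] by (rule DERIV_isCont)
    then have "filterlim (\<lambda>\<Theta>. \<bar>\<phi> \<Theta> f\<bar>) (nhds 0) (nhds 0)"
      using zero[OF that] tendsto_at_iff_tendsto_nhds[of "\<lambda>\<Theta>. \<phi> \<Theta> f" 0]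
      by (intro tendsto_rabs_zero) (simp add: isCont_def)
    then show ?thesis
      by (rule order_tendstoD) simp
  qed
  then have "\<forall>\<^sub>F \<Theta> in nhds 0. \<forall>f\<in>F. \<bar>\<phi> \<Theta> f\<bar> < pi / 2"
    using finite by (simp add: eventually_ball_finite)
  moreover have "\<forall>\<^sub>F \<Theta> in nhds 0. stationary F m S A \<Theta> (\<phi> \<Theta>)"
    using U stat by (auto simp: eventually_nhds)
  ultimately show ?thesis by (rule eventually_conj[rotated])
qed

lemma vacuum_branch_unique:
  assumes "vacuum_branch F m S A \<phi>" "vacuum_branch F m S A \<psi>"
  shows "\<forall>\<^sub>F \<Theta> in nhds 0. \<forall>f\<in>F. \<phi> \<Theta> f = \<psi> \<Theta> f"
  using vacuum_branch_eventually[OF assms(1)] vacuum_branch_eventually[OF assms(2)]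
  by eventually_elim (auto intro: stationary_unique)

text \<open>\<open>G\<close> is the right-hand side of the scalar equation and \<open>h\<close> its
  inverse, so \<open>h \<Theta>\<close> is the tension of the branch. Smoothness comes from an
  algebra whose generators include \<open>h\<close> and the phases.\<close>

lemma vacuum_branch_exists: "\<exists>\<phi>. vacuum_branch F m S A \<phi>"
proof -
  \<comment> \<open>Halving the least \<open>S * m f\<close> keeps every arcsine argument strictly
    inside (-1, 1) for tensions in \<open>J\<close>, where arcsine is differentiable.\<close>
  define c where "c = Min ((\<lambda>f. S * m f) ` F) / 2"
  have min_pos: "Min ((\<lambda>f. S * m f) ` F) > 0"
    using finite nonempty m_pos S_pos by (simp add: Min_gr_iff)
  then have c_pos: "c > 0" by (simp add: c_def)
  have c_less: "c < S * m f" if "f \<in> F" for f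
  proof -
    have "Min ((\<lambda>f. S * m f) ` F) \<le> S * m f"
      using finite that by (intro Min_le) auto
    with min_pos show ?thesis by (simp add: c_def)
  qed
  define J where "J = {- c<..<c}"
  define G where "G = (\<lambda>l. l / A + (\<Sum>f\<in>F. arcsin (l / (S * m f))))"
  define k where "k = (\<lambda>f. inverse (S * m f))"
  have k_pos: "k f > 0" if "f \<in> F" for f
    using m_pos[OF that] S_pos by (simp add: k_def)
  have range: "- 1 < l * k f" "l * k f < 1" if "l \<in> J" "f \<in> F" for l f
    using that c_less[OF that(2)] c_pos m_pos[OF that(2)] S_pos
    by (auto simp: J_def k_def field_simps)
  have G_eq: "G = (\<lambda>l. l / A + (\<Sum>f\<in>F. arcsin (l * k f)))"
    by (simp add: G_def k_def divide_inverse)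
  have cos_pos: "cos (arcsin (l * k f)) > 0" if "l \<in> J" "f \<in> F" for l f
    using arcsin_lt_bounded[OF range[OF that]] by (intro cos_gt_zero_pi) auto
  \<comment> \<open>The usual square root is written as the cosine of the phase, which will be a
    generator of the algebra.\<close>
  have arcsin_deriv: "((\<lambda>l. arcsin (l * k f)) has_real_derivative
      k f * inverse (cos (arcsin (l * k f)))) (at l)" if "l \<in> J" "f \<in> F" for l f
    using range[OF that]
    by (auto intro!: derivative_eq_intros simp: cos_arcsin)
  define G' where "G' = (\<lambda>l. 1 / A + (\<Sum>f\<in>F. k f * inverse (cos (arcsin (l * k f)))))"
  have G_deriv: "(G has_real_derivative G' l) (at l)" if "l \<in> J" for l
    unfolding G_eq G'_def
    by (intro DERIV_add DERIV_sum DERIV_cdivide DERIV_ident arcsin_deriv[OF that])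
  have G'_pos: "G' l > 0" if "l \<in> J" for l
    unfolding G'_def using A_pos k_pos cos_pos[OF that]
    by (intro add_pos_nonneg sum_nonneg) (auto intro: less_imp_le)
  have G_cont: "continuous_on J G"
    using G_deriv by (meson DERIV_isCont continuous_at_imp_continuous_on)
  have G_less: "G x < G y" if "x \<in> J" "y \<in> J" "x < y" for x y
  proof (rule DERIV_pos_imp_increasing[OF that(3)])
    fix z assume "x \<le> z" "z \<le> y"
    with that have "z \<in> J" by (auto simp: J_def)
    then show "\<exists>d. (G has_real_derivative d) (at z) \<and> d > 0"
      using G_deriv G'_pos by blast
  qed
  then have G_inj: "inj_on G J"
    by (intro inj_onI) (metis linorder_neqE_linordered_idom less_irrefl)
  define U where "U = G ` J"
  define h where "h = the_inv_into J G"
  define \<phi> where "\<phi> = (\<lambda>\<Theta> f. arcsin (h \<Theta> * k f))"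
  have "open J" by (simp add: J_def)
  \<comment> \<open>A continuous injective map on an open subset of the line is open.\<close>
  then have "open U"
    unfolding U_def using G_cont G_inj
    by (intro injective_into_1d_imp_open_map_UNIV[of J]) auto
  have "0 \<in> J" using c_pos by (simp add: J_def)
  have "G 0 = 0" by (simp add: G_def)
  with \<open>0 \<in> J\<close> have "0 \<in> U" unfolding U_def by force
  have h_G: "h (G l) = l" if "l \<in> J" for l
    using that G_inj by (simp add: h_def the_inv_into_f_f)
  have h_in: "h \<Theta> \<in> J" and G_h: "G (h \<Theta>) = \<Theta>" if "\<Theta> \<in> U" for \<Theta>
    using that h_G by (auto simp: U_def)
  have h_zero: "h 0 = 0"
    using h_G[OF \<open>0 \<in> J\<close>] \<open>G 0 = 0\<close> by simp
  \<comment> \<open>The reciprocal of \<open>G' (h \<Theta>)\<close>, expressed through cosines of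
    the phases so that it visibly lies in the algebra.\<close>
  define h' where "h' = (\<lambda>\<Theta>. inverse (1 / A + (\<Sum>f\<in>F. k f * inverse (cos (\<phi> \<Theta> f)))))"
  have h_deriv: "(h has_real_derivative h' \<Theta>) (at \<Theta>)" if "\<Theta> \<in> U" for \<Theta>
  proof -
    \<comment> \<open>Inverse function theorem, with \<open>G'\<close> nonzero because the term
      \<open>1 / A\<close> is positive and the others are nonnegative.\<close>
    have "(h has_real_derivative inverse (G' (h \<Theta>))) (at (G (h \<Theta>)))"
      using G_deriv[OF h_in[OF that]] G'_pos[OF h_in[OF that]]
      unfolding has_field_derivative_def
      by (intro has_derivative_inverse_strong[OF \<open>open J\<close> h_in[OF that] G_cont h_G])
        (auto simp: fun_eq_iff)
    then show ?thesis
      using that by (simp add: G_h h'_def G'_def \<phi>_def)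
  qed
  define \<phi>' where "\<phi>' = (\<lambda>f \<Theta>. k f * inverse (cos (\<phi> \<Theta> f)) * h' \<Theta>)"
  have \<phi>_deriv: "((\<lambda>\<Theta>. \<phi> \<Theta> f) has_real_derivative \<phi>' f \<Theta>) (at \<Theta>)" if "\<Theta> \<in> U" "f \<in> F" for \<Theta> f
    unfolding \<phi>_def \<phi>'_def
    by (rule DERIV_chain2[OF arcsin_deriv[OF h_in[OF that(1)] that(2)] h_deriv[OF that(1)]])
  have sin_\<phi>: "sin (\<phi> \<Theta> f) = h \<Theta> * k f" if "\<Theta> \<in> U" "f \<in> F" for \<Theta> f
    using range[OF h_in[OF that(1)] that(2)] by (simp add: \<phi>_def)
  \<comment> \<open>The cosines occur in \<open>h'\<close> and \<open>\<phi>'\<close>;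
    differentiating them produces sines, which are the multiples \<open>k f\<close> of
    \<open>h\<close>. Thus the generators have derivatives in the algebra.\<close>
  define B where "B = insert h ((\<lambda>f \<Theta>. \<phi> \<Theta> f) ` F \<union> (\<lambda>f \<Theta>. cos (\<phi> \<Theta> f)) ` F)"
  let ?C = "inv_closed_algebra U B"
  have h_C: "h \<in> ?C" and \<phi>_C: "f \<in> F \<Longrightarrow> (\<lambda>\<Theta>. \<phi> \<Theta> f) \<in> ?C"
    and cos_C: "f \<in> F \<Longrightarrow> (\<lambda>\<Theta>. cos (\<phi> \<Theta> f)) \<in> ?C" for f
    by (auto intro!: inv_closed_algebra.generator simp: B_def)
  have inv_cos_C: "(\<lambda>\<Theta>. k f * inverse (cos (\<phi> \<Theta> f))) \<in> ?C" if "f \<in> F" for f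
  proof (intro inv_closed_algebra.mult inv_closed_algebra.const inv_closed_algebra.inverse
      cos_C that)
    fix \<Theta> assume "\<Theta> \<in> U"
    then show "cos (\<phi> \<Theta> f) \<noteq> 0"
      using cos_pos[OF h_in that] by (force simp: \<phi>_def)
  qed
  have h'_C: "h' \<in> ?C"
    unfolding h'_def
  proof (intro inv_closed_algebra.inverse inv_closed_algebra.add inv_closed_algebra.const
      inv_closed_algebra_sum inv_cos_C)
    fix \<Theta> assume "\<Theta> \<in> U"
    then show "1 / A + (\<Sum>f\<in>F. k f * inverse (cos (\<phi> \<Theta> f))) \<noteq> 0"
      using G'_pos[OF h_in] by (force simp: G'_def \<phi>_def)
  qed
  have \<phi>'_C: "\<phi>' f \<in> ?C" if "f \<in> F" for f
    unfolding \<phi>'_def by (intro inv_closed_algebra.mult[OF inv_cos_C[OF that] h'_C])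
  have gens: "\<exists>b'\<in>?C. \<forall>x\<in>U. (b has_real_derivative b' x) (at x)" if "b \<in> B" for b
  proof -
    consider "b = h" | f where "f \<in> F" "b = (\<lambda>\<Theta>. \<phi> \<Theta> f)"
      | f where "f \<in> F" "b = (\<lambda>\<Theta>. cos (\<phi> \<Theta> f))"
      using \<open>b \<in> B\<close> by (auto simp: B_def)
    then show ?thesis
    proof cases
      case 1
      then show ?thesis using h_deriv by (intro bexI[OF _ h'_C]) simp
    next
      case (2 f)
      show ?thesis
        unfolding 2(2) using \<phi>_deriv 2(1) by (intro bexI[OF _ \<phi>'_C[OF 2(1)]] ballI)
    next
      case (3 f)
      have "((\<lambda>\<Theta>. cos (\<phi> \<Theta> f)) has_real_derivative (- k f) * (h \<Theta> * \<phi>' f \<Theta>)) (at \<Theta>)"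
        if "\<Theta> \<in> U" for \<Theta>
        using DERIV_chain2[OF DERIV_cos \<phi>_deriv[OF that \<open>f \<in> F\<close>]] sin_\<phi>[OF that \<open>f \<in> F\<close>]
        by (simp add: algebra_simps)
      moreover have "(\<lambda>\<Theta>. (- k f) * (h \<Theta> * \<phi>' f \<Theta>)) \<in> ?C"
        by (intro inv_closed_algebra.mult inv_closed_algebra.const h_C \<phi>'_C \<open>f \<in> F\<close>)
      ultimately show ?thesis unfolding 3(2) by (intro bexI ballI)
    qed
  qed
  have smooth: "smooth_on U (\<lambda>\<Theta>. \<phi> \<Theta> f)" if "f \<in> F" for f
    by (rule inv_closed_algebra_smooth_on[OF \<open>open U\<close> gens \<phi>_C[OF that]])
  have stat: "stationary F m S A \<Theta> (\<phi> \<Theta>)" if "\<Theta> \<in> U" for \<Theta>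
  proof -
    \<comment> \<open>This is \<open>G (h \<Theta>) = \<Theta>\<close>; solved for
      \<open>h \<Theta>\<close>, it identifies \<open>h \<Theta>\<close> with the tension.\<close>
    have "h \<Theta> / A + (\<Sum>f\<in>F. \<phi> \<Theta> f) = \<Theta>"
      using G_h[OF that] by (simp add: G_eq \<phi>_def)
    then have "tension \<Theta> (\<phi> \<Theta>) = h \<Theta>"
      using A_pos by (simp add: tension_def field_simps)
    moreover have "S * m f * sin (\<phi> \<Theta> f) = h \<Theta>" if "f \<in> F" for f
      using sin_\<phi>[OF \<open>\<Theta> \<in> U\<close> that] m_pos[OF that] S_pos by (simp add: k_def field_simps)
    ultimately show ?thesis by (simp add: stationary_iff)
  qed
  have "vacuum_branch F m S A \<phi>"
    unfolding vacuum_branch_def using \<open>open U\<close> \<open>0 \<in> U\<close> smooth stat h_zero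
    by (auto simp: \<phi>_def)
  then show ?thesis by (rule exI[of _ \<phi>])
qed

section \<open>Susceptibility\<close>

text \<open>Envelope argument: the chain-rule terms through the phases cancel by stationarity,
  leaving the explicit \<Theta>-derivative. It is stated on a neighborhood so that it can be
  differentiated once more.\<close>

lemma E_vac_derivative:
  assumes "vacuum_branch F m S A \<phi>"
  shows "\<forall>\<^sub>F \<Theta> in nhds 0. (E_vac F m S A \<phi> has_real_derivative tension \<Theta> (\<phi> \<Theta>)) (at \<Theta>)"
proof -
  from assms obtain U \<phi>' where U: "open U" "0 \<in> U"
    and stat: "\<And>\<Theta>. \<Theta> \<in> U \<Longrightarrow> stationary F m S A \<Theta> (\<phi> \<Theta>)"
    and deriv: "\<And>f \<Theta>. f \<in> F \<Longrightarrow> \<Theta> \<in> U \<Longrightarrow>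
      ((\<lambda>\<Theta>. \<phi> \<Theta> f) has_real_derivative \<phi>' f \<Theta>) (at \<Theta>)"
    by (rule vacuum_branchE) blast
  have "(E_vac F m S A \<phi> has_real_derivative tension \<Theta> (\<phi> \<Theta>)) (at \<Theta>)" if "\<Theta> \<in> U" for \<Theta>
  proof -
    have cos_deriv: "((\<lambda>\<Theta>. \<Sum>f\<in>F. m f * cos (\<phi> \<Theta> f)) has_real_derivative
        (\<Sum>f\<in>F. m f * (- sin (\<phi> \<Theta> f) * \<phi>' f \<Theta>))) (at \<Theta>)"
      using deriv[OF _ that] by (intro DERIV_sum DERIV_cmult DERIV_chain2[OF DERIV_cos]) auto
    have sum_deriv: "((\<lambda>\<Theta>. \<Sum>f\<in>F. \<phi> \<Theta> f) has_real_derivative (\<Sum>f\<in>F. \<phi>' f \<Theta>)) (at \<Theta>)"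
      using deriv[OF _ that] by (intro DERIV_sum) auto
    have E_deriv: "((\<lambda>\<Theta>. - S * (\<Sum>f\<in>F. m f * cos (\<phi> \<Theta> f)) + A / 2 * (\<Theta> - (\<Sum>f\<in>F. \<phi> \<Theta> f))\<^sup>2)
        has_real_derivative
          - S * (\<Sum>f\<in>F. m f * (- sin (\<phi> \<Theta> f) * \<phi>' f \<Theta>))
          + tension \<Theta> (\<phi> \<Theta>) * (1 - (\<Sum>f\<in>F. \<phi>' f \<Theta>))) (at \<Theta>)"
      by (rule derivative_eq_intros cos_deriv sum_deriv refl)+ (simp add: tension_def)
    \<comment> \<open>Stationarity replaces each \<open>S * m f * sin (\<phi> \<Theta> f)\<close> by
      the tension; the result cancels the phase part of the quadratic term.\<close>
    have "- S * (\<Sum>f\<in>F. m f * (- sin (\<phi> \<Theta> f) * \<phi>' f \<Theta>)) =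
        tension \<Theta> (\<phi> \<Theta>) * (\<Sum>f\<in>F. \<phi>' f \<Theta>)"
    proof -
      have "- S * (\<Sum>f\<in>F. m f * (- sin (\<phi> \<Theta> f) * \<phi>' f \<Theta>)) =
          (\<Sum>f\<in>F. S * m f * sin (\<phi> \<Theta> f) * \<phi>' f \<Theta>)"
        by (simp add: sum_distrib_left sum_negf mult.assoc)
      also have "\<dots> = (\<Sum>f\<in>F. tension \<Theta> (\<phi> \<Theta>) * \<phi>' f \<Theta>)"
        using stat[OF that] by (intro sum.cong) (auto simp: stationary_iff)
      finally show ?thesis by (simp add: sum_distrib_left)
    qed
    then have "- S * (\<Sum>f\<in>F. m f * (- sin (\<phi> \<Theta> f) * \<phi>' f \<Theta>))
        + tension \<Theta> (\<phi> \<Theta>) * (1 - (\<Sum>f\<in>F. \<phi>' f \<Theta>)) = tension \<Theta> (\<phi> \<Theta>)"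
      by (simp only: right_diff_distrib)
    then show ?thesis
      using E_deriv unfolding E_vac_def[abs_def] V_F_def by (simp only:)
  qed
  with U show ?thesis by (auto simp: eventually_nhds)
qed

text \<open>Implicit differentiation of the stationarity equations at 0, where all cosines are 1,
  expresses each phase slope through the tension slope \<open>L\<close>. The definition of the
  tension then yields a linear equation for \<open>L\<close>.\<close>

lemma tension_derivative:
  assumes "vacuum_branch F m S A \<phi>"
  shows "((\<lambda>\<Theta>. tension \<Theta> (\<phi> \<Theta>)) has_real_derivative
    inverse (1 / A + (\<Sum>f\<in>F. 1 / (m f * S)))) (at 0)"
proof -
  from assms obtain U \<phi>' where U: "open U" "0 \<in> U"
    and stat: "\<And>\<Theta>. \<Theta> \<in> U \<Longrightarrow> stationary F m S A \<Theta> (\<phi> \<Theta>)"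
    and zero: "\<And>f. f \<in> F \<Longrightarrow> \<phi> 0 f = 0"
    and deriv: "\<And>f \<Theta>. f \<in> F \<Longrightarrow> \<Theta> \<in> U \<Longrightarrow>
      ((\<lambda>\<Theta>. \<phi> \<Theta> f) has_real_derivative \<phi>' f \<Theta>) (at \<Theta>)"
    by (rule vacuum_branchE) blast
  define L where "L = A * (1 - (\<Sum>f\<in>F. \<phi>' f 0))"
  have tension_deriv: "((\<lambda>\<Theta>. tension \<Theta> (\<phi> \<Theta>)) has_real_derivative L) (at 0)"
    unfolding tension_def L_def using deriv[OF _ U(2)]
    by (intro DERIV_cmult DERIV_diff DERIV_ident DERIV_sum) auto
  have "\<phi>' f 0 = L * (1 / (m f * S))" if "f \<in> F" for f
  proof -
    have "((\<lambda>\<Theta>. S * m f * sin (\<phi> \<Theta> f)) has_real_derivative S * m f * (cos (\<phi> 0 f) * \<phi>' f 0)) (at 0)"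
      using deriv[OF that U(2)] by (intro DERIV_cmult DERIV_chain2[OF DERIV_sin])
    \<comment> \<open>By stationarity this function equals the tension on the open set
      \<open>U\<close>, so it has the same slope at 0.\<close>
    moreover have "((\<lambda>\<Theta>. S * m f * sin (\<phi> \<Theta> f)) has_real_derivative L) (at 0)"
      using tension_deriv U stat that
      by (elim has_field_derivative_transform_within_open) (auto simp: stationary_iff)
    ultimately have "S * m f * (cos (\<phi> 0 f) * \<phi>' f 0) = L"
      by (rule DERIV_unique)
    then show ?thesis
      using zero[OF that] m_pos[OF that] S_pos by (simp add: field_simps)
  qed
  then have "(\<Sum>f\<in>F. \<phi>' f 0) = L * (\<Sum>f\<in>F. 1 / (m f * S))"
    unfolding sum_distrib_left by (intro sum.cong) auto
  then have "L = A * (1 - L * (\<Sum>f\<in>F. 1 / (m f * S)))"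
    using L_def by simp
  moreover have "L * (1 / A + T) = 1" if "L = A * (1 - L * T)" for T
    using A_pos that by (simp add: field_simps)
  ultimately have "L * (1 / A + (\<Sum>f\<in>F. 1 / (m f * S))) = 1" by blast
  then have "L = inverse (1 / A + (\<Sum>f\<in>F. 1 / (m f * S)))"
    by (metis inverse_unique mult.commute)
  with tension_deriv show ?thesis by simp
qed

lemma E_vac_second_derivative:
  assumes "vacuum_branch F m S A \<phi>"
  shows "twice_differentiable_at (E_vac F m S A \<phi>) 0"
    and "chi_top F m S A \<phi> = inverse (1 / A + (\<Sum>f\<in>F. 1 / (m f * S)))"
  unfolding chi_top_def
  by (rule second_derivative_from_local_derivative[OF E_vac_derivative tension_derivative, OF assms assms])+

text \<open>Up to a constant, \<open>V_a\<close> is \<open>E_vac\<close> composed with an affine map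
  of slope \<open>1 / f_a\<close>, and each differentiation contributes one such factor.\<close>

lemma V_a_second_derivative:
  assumes branch: "vacuum_branch F m S A \<phi>" and "f_a > 0" and a\<^sub>0: "\<theta> + a\<^sub>0 / f_a = 0"
  shows "twice_differentiable_at (V_a F m S A \<phi> \<theta> f_a) a\<^sub>0"
    and "axion_mass_sq F m S A \<phi> \<theta> f_a a\<^sub>0 * f_a\<^sup>2 = chi_top F m S A \<phi>"
proof -
  let ?\<Theta> = "\<lambda>a. \<theta> + a / f_a"
  let ?\<chi> = "inverse (1 / A + (\<Sum>f\<in>F. 1 / (m f * S)))"
  have \<Theta>_deriv: "(?\<Theta> has_real_derivative 1 / f_a) (at a)" for a
    using \<open>f_a > 0\<close> by (auto intro!: derivative_eq_intros)
  have "isCont ?\<Theta> a\<^sub>0" using \<Theta>_deriv by (rule DERIV_isCont)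
  \<comment> \<open>Continuity carries the neighborhood statement about \<open>E_vac\<close> at 0
    back to one at \<open>a\<^sub>0\<close>.\<close>
  then have "filterlim ?\<Theta> (nhds 0) (nhds a\<^sub>0)"
    using a\<^sub>0 tendsto_at_iff_tendsto_nhds[of ?\<Theta> a\<^sub>0] by (simp add: isCont_def)
  with E_vac_derivative[OF branch]
  have "\<forall>\<^sub>F a in nhds a\<^sub>0.
      (E_vac F m S A \<phi> has_real_derivative tension (?\<Theta> a) (\<phi> (?\<Theta> a))) (at (?\<Theta> a))"
    by (rule eventually_compose_filterlim)
  then have first: "\<forall>\<^sub>F a in nhds a\<^sub>0. (V_a F m S A \<phi> \<theta> f_a has_real_derivative
      tension (?\<Theta> a) (\<phi> (?\<Theta> a)) * (1 / f_a)) (at a)"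
  proof eventually_elim
    case (elim a)
    then show ?case
      using DERIV_diff[OF DERIV_chain2[OF elim \<Theta>_deriv] DERIV_const]
      by (simp add: V_a_def[abs_def])
  qed
  have "((\<lambda>\<Theta>. tension \<Theta> (\<phi> \<Theta>)) has_real_derivative ?\<chi>) (at (?\<Theta> a\<^sub>0))"
    unfolding a\<^sub>0 by (rule tension_derivative[OF branch])
  then have second: "((\<lambda>a. tension (?\<Theta> a) (\<phi> (?\<Theta> a)) * (1 / f_a)) has_real_derivative
      ?\<chi> * (1 / f_a) * (1 / f_a)) (at a\<^sub>0)"
    by (intro DERIV_cmult_right DERIV_chain2[OF _ \<Theta>_deriv])
  show "twice_differentiable_at (V_a F m S A \<phi> \<theta> f_a) a\<^sub>0"
    using second_derivative_from_local_derivative(1)[OF first second] .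
  have "axion_mass_sq F m S A \<phi> \<theta> f_a a\<^sub>0 = ?\<chi> * (1 / f_a) * (1 / f_a)"
    unfolding axion_mass_sq_def
    using second_derivative_from_local_derivative(2)[OF first second] .
  then show "axion_mass_sq F m S A \<phi> \<theta> f_a a\<^sub>0 * f_a\<^sup>2 = chi_top F m S A \<phi>"
    using \<open>f_a > 0\<close> E_vac_second_derivative(2)[OF branch] by (simp add: power2_eq_square)
qed

end

text \<open>Existence and uniqueness of the germ justify speaking of the solution. Since
  \<open>deriv\<close> is total, twice differentiability is asserted together with the values, so
  that these are genuine second derivatives.\<close>

theorem theorem1:
  fixes F :: "'f set" and m :: "'f \<Rightarrow> real" and S A f_a \<theta>\<^sub>Q\<^sub>C\<^sub>D :: real
  assumes "finite F" and "F \<noteq> {}"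
    and "\<forall>f\<in>F. m f > 0"
    and "S > 0" and "A > 0" and "f_a > 0"
  shows "(\<exists>\<phi>. vacuum_branch F m S A \<phi>) \<and>
    (\<forall>\<phi> \<psi>. vacuum_branch F m S A \<phi> \<longrightarrow> vacuum_branch F m S A \<psi> \<longrightarrow>
       (\<forall>\<^sub>F \<Theta> in nhds 0. \<forall>f\<in>F. \<phi> \<Theta> f = \<psi> \<Theta> f)) \<and>
    (\<forall>\<phi>. vacuum_branch F m S A \<phi> \<longrightarrow>
       twice_differentiable_at (E_vac F m S A \<phi>) 0 \<and>
       chi_top F m S A \<phi> = inverse (1 / A + (\<Sum>f\<in>F. 1 / (m f * S))) \<and>
       (\<forall>a\<^sub>0. \<theta>\<^sub>Q\<^sub>C\<^sub>D + a\<^sub>0 / f_a = 0 \<longrightarrow>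
          twice_differentiable_at (V_a F m S A \<phi> \<theta>\<^sub>Q\<^sub>C\<^sub>D f_a) a\<^sub>0 \<and>
          axion_mass_sq F m S A \<phi> \<theta>\<^sub>Q\<^sub>C\<^sub>D f_a a\<^sub>0 * f_a\<^sup>2 = chi_top F m S A \<phi>))"
proof -
  interpret chiral_potential F m S A
    using assms by unfold_locales auto
  show ?thesis
    by (intro conjI allI impI vacuum_branch_exists vacuum_branch_unique
        E_vac_second_derivative V_a_second_derivative assms)
qed

end
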